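(* Let $p\ge5$ be a prime. Then: (1) for every odd $i$ with $0 < i < p-1$, the entry $(i,i)$ of $F(p,-2)$ is zero; (2) for every odd $i$ with $0 < i < p-1$, the entry $(i,p-1-i)$ of $F(p,-2^{-1})$ is zero; (3) for every even $i$ with $0\le i\le p-1$, the entry $(i,i)$ of $F(p,-2)$ and the entry $(i,p-1-i)$ of $F(p,-2^{-1})$ are nonzero.
   Context: For $m\in\mathbb{F}_p$, $F(p,m) = (a_{i,j})_{0\le i,j\le p-1}$ is the $p\times p$ matrix over $\mathbb{F}_p$ with $a_{i,0} = a_{0,j}=1$ and $a_{i,j} = a_{i-1,j} + m\,a_{i-1,j-1} + a_{i,j-1}$ for $i,j\ge1$. Here $-2$ and $-2^{-1}$ are elements of $\mathbb{F}_p$. *)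

theory Defs
  imports "Berlekamp_Zassenhaus.Finite_Field" "Jordan_Normal_Form.Matrix"
begin

fun F_entry :: "'a :: comm_ring_1 \<Rightarrow> nat \<Rightarrow> nat \<Rightarrow> 'a" where
  "F_entry m 0 j = 1"
| "F_entry m (Suc i) 0 = 1"
| "F_entry m (Suc i) (Suc j) = F_entry m i (Suc j) + m * F_entry m i j + F_entry m (Suc i) j"

text \<open>The prime field with \<open>p\<close> elements is \<open>'q mod_ring\<close>, where \<open>'q\<close> is a type of
  prime cardinality \<open>p\<close>; the matrix size \<open>p\<close> has to be tied to \<open>CARD('q)\<close> at the point of use.\<close>

definition F :: "nat \<Rightarrow> 'q :: prime_card mod_ring \<Rightarrow> 'q mod_ring mat" where
  "F p m = mat p p (\<lambda>(i, j). F_entry m i j)"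

end

theory Submission
  imports Defs
begin

text \<open>
  With \<open>t = 1 + m\<close>, the entry \<open>(i, j)\<close> is \<open>\<Sum>\<^sub>k C(i,k) C(j,k) t\<^sup>k\<close>. For \<open>m = -2\<close> and \<open>j = i\<close> this is
  \<open>\<Sum>\<^sub>k (-1)\<^sup>k C(i,k)\<^sup>2\<close>, the coefficient of \<open>x\<^sup>i\<close> in \<open>(1 - x\<^sup>2)\<^sup>i\<close>: it vanishes for odd \<open>i\<close> and
  is \<open>\<plusminus>C(i,i/2)\<close> for even \<open>i\<close>. For \<open>m = -1/2\<close> and \<open>j = p - 1 - i\<close>, the congruence
  \<open>C(p-1-i,k) \<equiv> (-1)\<^sup>k C(i+k,k)\<close> turns the entry into \<open>\<Sum>\<^sub>k C(i,k) C(i+k,k) (-1/2)\<^sup>k\<close>, the value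
  at 0 of the \<open>i\<close>-th Legendre polynomial, which equals \<open>2\<^sup>-\<^sup>i \<Sum>\<^sub>k (-1)\<^sup>k C(i,k)\<^sup>2\<close>.
\<close>

text \<open>By Pascal's rule, taking differences in both \<open>i\<close> and \<open>j\<close>
  lowers each index \<open>k\<close> by one, which produces the factor \<open>1 + m\<close> of the
  recurrence. The free bound \<open>N\<close> lets all four sums in the recurrence run over one
  range.\<close>

lemma F_entry_eq_sum:
  fixes m :: "'a :: comm_ring_1"
  assumes "i \<le> N"
  shows "F_entry m i j = (\<Sum>k\<le>N. of_nat (i choose k) * of_nat (j choose k) * (1 + m) ^ k)"
  using assms
proof (induction m i j rule: F_entry.induct)
  case (1 m j)
  then show ?case
    by (simp add: sum.atMost_shift)
next
  case (2 m i)
  then show ?case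
    by (simp add: sum.atMost_shift)
next
  case (3 m i j)
  let ?S = "\<lambda>i j. \<Sum>k\<le>N. of_nat (i choose k) * of_nat (j choose k) * (1 + m) ^ k"
  obtain M where M: "N = Suc M" "i \<le> M"
    using "3.prems" by (cases N) auto
  have "?S (Suc i) (Suc j) - ?S i (Suc j) - ?S (Suc i) j + ?S i j
      = (\<Sum>k\<le>N. (of_nat (Suc i choose k) * of_nat (Suc j choose k)
           - of_nat (i choose k) * of_nat (Suc j choose k)
           - of_nat (Suc i choose k) * of_nat (j choose k)
           + of_nat (i choose k) * of_nat (j choose k)) * (1 + m) ^ k)"
    by (simp add: sum_subtractf sum.distrib algebra_simps)
  \<comment> \<open>The \<open>k = 0\<close> term is 1 - 1 - 1 + 1 = 0; in the others Pascal's rule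
    factors the bracket as a product of two differences.\<close>
  also have "\<dots> = (\<Sum>k\<le>M. of_nat (i choose k) * of_nat (j choose k) * (1 + m) ^ Suc k)"
    unfolding M(1) sum.atMost_Suc_shift by (simp add: algebra_simps)
  also have "\<dots> = (1 + m) * (\<Sum>k\<le>M. of_nat (i choose k) * of_nat (j choose k) * (1 + m) ^ k)"
    by (simp add: sum_distrib_left mult_ac)
  \<comment> \<open>The added term \<open>k = N\<close> vanishes because
    \<open>i \<le> M < N\<close>.\<close>
  also have "(\<Sum>k\<le>M. of_nat (i choose k) * of_nat (j choose k) * (1 + m) ^ k) = ?S i j"
    using M by (simp add: binomial_eq_0)
  finally have "?S (Suc i) (Suc j) = ?S i (Suc j) + m * ?S i j + ?S (Suc i) j"
    by (simp add: algebra_simps)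
  with 3 show ?case
    by simp
qed

lemma alternating_sum_choose_squares:
  fixes n :: nat
  shows "(\<Sum>k\<le>n. (-1) ^ k * of_nat (n choose k) ^ 2 :: 'a :: comm_ring_1)
       = (if even n then (-1) ^ (n div 2) * of_nat (n choose (n div 2)) else 0)"
proof -
  \<comment> \<open>The symmetry of the binomial coefficients turns the convolution of the two
    factors into a sum of squares.\<close>
  have "(\<Sum>k\<le>n. (-1) ^ k * of_nat (n choose k) ^ 2 :: 'a)
      = coeff ([:1, -1:] ^ n * [:1, 1:] ^ n) n"
    unfolding coeff_mult
    by (intro sum.cong refl)
       (simp add: coeff_linear_poly_power power2_eq_square mult_ac flip: binomial_symmetric)
  also have "[:1, -1:] ^ n * [:1, 1:] ^ n = (monom (-1 :: 'a) 2 + 1) ^ n"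
    by (simp add: monom_altdef one_pCons numeral_2_eq_2 flip: power_mult_distrib)
  also have "\<dots> = (\<Sum>k\<le>n. monom (of_nat (n choose k) * (-1) ^ k) (2 * k))"
    by (simp add: binomial_ring monom_power of_nat_monom mult_monom mult_ac)
  also have "coeff \<dots> n = (\<Sum>k\<le>n. if k = n div 2 \<and> even n then of_nat (n choose k) * (-1) ^ k else 0)"
    by (auto simp: coeff_sum intro!: sum.cong)
  also have "\<dots> = (if even n then (-1) ^ (n div 2) * of_nat (n choose (n div 2)) else 0)"
    by (auto simp: mult_ac)
  finally show ?thesis .
qed

text \<open>Rewriting C(n,k) C(k,l) as C(n,l) C(n-l,k-l) leaves a binomial expansion of
  \<open>(1 + t) ^ (n - l)\<close>.\<close>

lemma sum_choose_mult_choose_power: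
  fixes t :: "'a :: comm_ring_1"
  assumes "l \<le> n"
  shows "(\<Sum>k\<le>n. of_nat (n choose k) * of_nat (k choose l) * t ^ k)
       = of_nat (n choose l) * t ^ l * (1 + t) ^ (n - l)"
proof -
  have "(\<Sum>k\<le>n. of_nat (n choose k) * of_nat (k choose l) * t ^ k)
      = (\<Sum>k=l..n. of_nat (n choose k) * of_nat (k choose l) * t ^ k)"
    by (rule sum.mono_neutral_right) (auto simp: binomial_eq_0)
  also have "\<dots> = (\<Sum>k=l..n. of_nat (n choose l) * of_nat ((n - l) choose (k - l)) * t ^ k)"
    by (intro sum.cong refl) (metis atLeastAtMost_iff choose_mult of_nat_mult)
  also have "\<dots> = (\<Sum>k\<le>n - l. of_nat (n choose l) * of_nat ((n - l) choose k) * t ^ (k + l))"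
    by (rule sum.reindex_bij_witness[of _ "\<lambda>k. k + l" "\<lambda>k. k - l"]) (use assms in auto)
  also have "\<dots> = of_nat (n choose l) * t ^ l * (t + 1) ^ (n - l)"
    by (simp add: binomial_ring sum_distrib_left power_add mult_ac)
  finally show ?thesis
    by (simp add: add.commute)
qed

text \<open>Vandermonde expands C(n+k,k), and swapping the sums makes the sum over \<open>k\<close>
  a binomial one. At t = -1/2 the two powers on the right merge into (-1)^l 2^(-n), leaving an
  alternating sum of squares.\<close>

lemma legendre_sum_eq:
  fixes t :: "'a :: comm_ring_1"
  shows "(\<Sum>k\<le>n. of_nat (n choose k) * of_nat ((n + k) choose k) * t ^ k)
       = (\<Sum>l\<le>n. of_nat (n choose l) ^ 2 * t ^ l * (1 + t) ^ (n - l))"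
proof -
  have vand: "(n + k) choose k = (\<Sum>l\<le>n. (n choose l) * (k choose l))" if "k \<le> n" for k
  proof -
    have "(n + k) choose k = (\<Sum>l\<le>k. (n choose l) * (k choose (k - l)))"
      by (rule vandermonde[symmetric])
    also have "\<dots> = (\<Sum>l\<le>k. (n choose l) * (k choose l))"
      by (simp flip: binomial_symmetric)
    also have "\<dots> = (\<Sum>l\<le>n. (n choose l) * (k choose l))"
      using that by (intro sum.mono_neutral_left) auto
    finally show ?thesis .
  qed
  have "(\<Sum>k\<le>n. of_nat (n choose k) * of_nat ((n + k) choose k) * t ^ k)
      = (\<Sum>k\<le>n. \<Sum>l\<le>n. of_nat (n choose l) * (of_nat (n choose k) * of_nat (k choose l) * t ^ k))"
    by (simp add: vand sum_distrib_left sum_distrib_right mult_ac)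
  also have "\<dots> = (\<Sum>l\<le>n. of_nat (n choose l) * (\<Sum>k\<le>n. of_nat (n choose k) * of_nat (k choose l) * t ^ k))"
    by (subst sum.swap) (simp add: sum_distrib_left)
  also have "\<dots> = (\<Sum>l\<le>n. of_nat (n choose l) ^ 2 * t ^ l * (1 + t) ^ (n - l))"
    by (intro sum.cong refl, subst sum_choose_mult_choose_power) (simp_all add: power2_eq_square mult_ac)
  finally show ?thesis .
qed

lemma of_nat_mod_ring_eq_0_iff:
  "(of_nat n :: 'q :: prime_card mod_ring) = 0 \<longleftrightarrow> CARD('q) dvd n"
  by (simp add: of_nat_eq_0_iff_char_dvd)

text \<open>The coefficient divides \<open>fact n\<close>, whose factors are all below the
  prime.\<close>

lemma of_nat_choose_mod_ring_nonzero:
  assumes "n < CARD('q :: prime_card)" "k \<le> n"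
  shows "(of_nat (n choose k) :: 'q mod_ring) \<noteq> 0"
proof
  assume "(of_nat (n choose k) :: 'q mod_ring) = 0"
  then have "CARD('q) dvd n choose k"
    by (simp add: of_nat_mod_ring_eq_0_iff)
  also have "n choose k dvd fact n"
    using binomial_fact_lemma[OF assms(2)] by (metis dvd_triv_right)
  finally show False
    using assms(1) prime_card[where 'a = 'q] by (simp add: prime_dvd_fact_iff)
qed

text \<open>Modulo p the upper index is -1-i, so this is the negation rule for binomial
  coefficients. Induction with Pascal's rule avoids dividing by k!.\<close>

lemma of_nat_choose_reflect_mod_ring:
  assumes "i < CARD('q :: prime_card)" "k < CARD('q)"
  shows "(of_nat ((CARD('q) - 1 - i) choose k) :: 'q mod_ring) = (-1) ^ k * of_nat ((i + k) choose k)"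
  using assms
proof (induction i arbitrary: k)
  case 0
  then show ?case
  proof (induction k)
    case (Suc k)
    \<comment> \<open>This needs 0 < k+1 < p, hence the bound on \<open>k\<close> in the
      lemma.\<close>
    have "CARD('q) dvd CARD('q) choose Suc k"
      using Suc.prems by (intro dvd_choose_prime prime_card) auto
    then have "(of_nat (Suc (CARD('q) - 1) choose Suc k) :: 'q mod_ring) = 0"
      by (simp add: of_nat_mod_ring_eq_0_iff)
    then have "(of_nat ((CARD('q) - 1) choose Suc k) :: 'q mod_ring)
             = - of_nat ((CARD('q) - 1) choose k)"
      unfolding binomial_Suc_Suc of_nat_add by (simp add: eq_neg_iff_add_eq_0 add.commute)
    with Suc show ?case
      by simp
  qed simp
next
  case (Suc i)
  note IH = Suc.IH and i = Suc.prems(1)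
  show ?case
    using Suc.prems(2)
  proof (induction k)
    case (Suc k)
    have "CARD('q) - 1 - i = Suc (CARD('q) - 1 - Suc i)"
      using i by simp
    then have "(of_nat ((CARD('q) - 1 - i) choose Suc k) :: 'q mod_ring)
             = of_nat ((CARD('q) - 1 - Suc i) choose k) + of_nat ((CARD('q) - 1 - Suc i) choose Suc k)"
      by (metis binomial_Suc_Suc of_nat_add)
    moreover have "(of_nat ((CARD('q) - 1 - i) choose Suc k) :: 'q mod_ring)
             = (-1) ^ Suc k * of_nat ((i + Suc k) choose Suc k)"
      using i Suc.prems by (intro IH) auto
    moreover have "(of_nat ((CARD('q) - 1 - Suc i) choose k) :: 'q mod_ring)
             = (-1) ^ k * of_nat ((Suc i + k) choose k)"
      using Suc by auto
    ultimately show ?case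
      by (simp add: algebra_simps)
  qed simp
qed

lemma F_entry_neg2_diag:
  "(F_entry (- 2) i i :: 'a :: comm_ring_1)
     = (if even i then (-1) ^ (i div 2) * of_nat (i choose (i div 2)) else 0)"
proof -
  have "(F_entry (- 2) i i :: 'a) = (\<Sum>k\<le>i. (-1) ^ k * of_nat (i choose k) ^ 2)"
    by (simp add: F_entry_eq_sum[OF order_refl] power2_eq_square mult_ac)
  then show ?thesis
    by (simp only: alternating_sum_choose_squares)
qed

lemma F_entry_neg_half_antidiag:
  assumes "i < CARD('q :: prime_card)" and two: "(2 :: 'q mod_ring) \<noteq> 0"
  shows "(F_entry (- inverse 2) i (CARD('q) - 1 - i) :: 'q mod_ring)
       = inverse 2 ^ i * F_entry (- 2) i i"
proof -
  let ?h = "inverse 2 :: 'q mod_ring"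
  \<comment> \<open>Used twice: for \<open>1 + m\<close> at \<open>m = - ?h\<close>, and for
    \<open>1 + t\<close> at \<open>t = - ?h\<close> in the Legendre sum.\<close>
  have h: "1 - ?h = ?h"
    using two by (simp add: field_simps)
  have "F_entry (- ?h) i (CARD('q) - 1 - i)
      = (\<Sum>k\<le>i. of_nat (i choose k) * of_nat ((CARD('q) - 1 - i) choose k) * ?h ^ k)"
    by (simp only: F_entry_eq_sum[OF order_refl] h flip: diff_conv_add_uminus)
  also have "\<dots> = (\<Sum>k\<le>i. of_nat (i choose k) * of_nat ((i + k) choose k) * (- ?h) ^ k)"
  proof (intro sum.cong refl)
    fix k assume "k \<in> {..i}"
    then have "k < CARD('q)"
      using assms(1) by simp
    then show "of_nat (i choose k) * of_nat ((CARD('q) - 1 - i) choose k) * ?h ^ k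
             = of_nat (i choose k) * of_nat ((i + k) choose k) * (- ?h) ^ k"
      by (simp only: of_nat_choose_reflect_mod_ring[OF assms(1)] power_minus[of ?h] mult_ac)
  qed
  also have "\<dots> = (\<Sum>l\<le>i. of_nat (i choose l) ^ 2 * (- ?h) ^ l * ?h ^ (i - l))"
    by (simp only: legendre_sum_eq h flip: diff_conv_add_uminus)
  also have "\<dots> = (\<Sum>l\<le>i. ?h ^ i * (of_nat (i choose l) * of_nat (i choose l) * (-1) ^ l))"
  proof (intro sum.cong refl)
    fix l assume "l \<in> {..i}"
    then have "?h ^ i = ?h ^ l * ?h ^ (i - l)"
      by (simp flip: power_add)
    then show "of_nat (i choose l) ^ 2 * (- ?h) ^ l * ?h ^ (i - l)
             = ?h ^ i * (of_nat (i choose l) * of_nat (i choose l) * (-1) ^ l)"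
      by (simp only: power_minus[of ?h] power2_eq_square mult_ac)
  qed
  also have "\<dots> = ?h ^ i * F_entry (- 2) i i"
    by (simp add: F_entry_eq_sum[OF order_refl] sum_distrib_left)
  finally show ?thesis .
qed

theorem theorem5p4:
  fixes p :: nat
  assumes "prime p" and "p \<ge> 5" and "CARD('q :: prime_card) = p"
  shows "(\<forall>i. odd i \<and> 0 < i \<and> i < p - 1 \<longrightarrow>
            F p (- 2 :: 'q mod_ring) $$ (i, i) = 0) \<and>
         (\<forall>i. odd i \<and> 0 < i \<and> i < p - 1 \<longrightarrow>
            F p (- inverse 2 :: 'q mod_ring) $$ (i, p - 1 - i) = 0) \<and>
         (\<forall>i. even i \<and> 0 \<le> i \<and> i \<le> p - 1 \<longrightarrow>
            F p (- 2 :: 'q mod_ring) $$ (i, i) \<noteq> 0 \<and>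
            F p (- inverse 2 :: 'q mod_ring) $$ (i, p - 1 - i) \<noteq> 0)"
proof -
  have two: "(2 :: 'q mod_ring) \<noteq> 0"
    using of_nat_mod_ring_eq_0_iff[of 2, where 'q = 'q] assms by (auto dest: dvd_imp_le)
  have diag: "F p (- 2 :: 'q mod_ring) $$ (i, i) = F_entry (- 2) i i" if "i < p" for i
    using that by (simp add: F_def)
  \<comment> \<open>As \<open>inverse 2 ^ i\<close> is a unit, the antidiagonal entry vanishes
    exactly when the diagonal one does.\<close>
  have anti: "F p (- inverse 2 :: 'q mod_ring) $$ (i, p - 1 - i) = inverse 2 ^ i * F_entry (- 2) i i"
    if "i < p" for i
    using that F_entry_neg_half_antidiag[of i, where 'q = 'q] two assms(3) by (simp add: F_def)
  have odd0: "(F_entry (- 2) i i :: 'q mod_ring) = 0" if "odd i" for i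
    using that by (simp add: F_entry_neg2_diag)
  have even_nz: "(F_entry (- 2) i i :: 'q mod_ring) \<noteq> 0" if "even i" "i < p" for i
    using that assms(3) of_nat_choose_mod_ring_nonzero[of i "i div 2", where 'q = 'q]
    by (simp add: F_entry_neg2_diag)
  have lt: "i < p" if "i \<le> p - 1" for i
    using that assms(2) by linarith
  show ?thesis
    using diag anti odd0 even_nz two lt by auto
qed

end
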